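(* For every fixed $K>5$, there are only finitely many odd perfect numbers $N$ such that for some prime $q$ and integer $\alpha\ge 1$ with $q^{\alpha}\,\|\,N$ we have $$\frac{\sigma(N/q^{\alpha})}{q^{\alpha}}<K.$$ Moreover, all such $N$ are bounded by some effectively computable number depending only on $K$.
   Context: For a positive integer $n$, $\sigma(n)$ denotes the sum of the positive divisors of $n$. A positive integer $N$ is perfect if $\sigma(N)=2N$. The notation $q^{\alpha}\,\|\,N$ means that $q^{\alpha}\mid N$ but $q^{\alpha+1}\nmid N$. *)

theory Defs
  imports Complex_Main "HOL-Computational_Algebra.Primes"
begin

definition sigma :: "nat \<Rightarrow> nat" where
  "sigma n = (\<Sum>d | d dvd n. d)"

definition perfect :: "nat \<Rightarrow> bool" where
  "perfect N \<longleftrightarrow> N > 0 \<and> sigma N = 2 * N"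

definition exactly_divides :: "nat \<Rightarrow> nat \<Rightarrow> nat \<Rightarrow> bool" where
  "exactly_divides q \<alpha> N \<longleftrightarrow> q ^ \<alpha> dvd N \<and> \<not> q ^ (\<alpha> + 1) dvd N"

text \<open>
  Kleene's general recursive functions: the total functions obtained from zero, successor and
  projections by composition, primitive recursion and minimisation of regular functions.
  A function of arity \<open>n\<close> is represented on lists, and only its values on lists of length \<open>n\<close>
  are meaningful. Minimisation is allowed only where a zero always exists, so
  \<open>LEAST\<close> never picks an unspecified value and the class is exactly the total computable functions.
\<close>

inductive general_recursive :: "nat \<Rightarrow> (nat list \<Rightarrow> nat) \<Rightarrow> bool" where
  zero: "general_recursive n (\<lambda>xs. 0)"
| succ: "general_recursive 1 (\<lambda>xs. Suc (hd xs))"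
| proj: "i < n \<Longrightarrow> general_recursive n (\<lambda>xs. xs ! i)"
| comp: "general_recursive (length gs) f \<Longrightarrow> \<forall>g\<in>set gs. general_recursive n g
    \<Longrightarrow> general_recursive n (\<lambda>xs. f (map (\<lambda>g. g xs) gs))"
| prim_rec: "general_recursive n f \<Longrightarrow> general_recursive (Suc (Suc n)) g
    \<Longrightarrow> general_recursive (Suc n)
          (\<lambda>xs. rec_nat (f (tl xs)) (\<lambda>y r. g (y # r # tl xs)) (hd xs))"
| minimise: "general_recursive (Suc n) f \<Longrightarrow> \<forall>xs. length xs = n \<longrightarrow> (\<exists>y. f (y # xs) = 0)
    \<Longrightarrow> general_recursive n (\<lambda>xs. LEAST y. f (y # xs) = 0)"

definition computable :: "(nat \<Rightarrow> nat) \<Rightarrow> bool" where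
  "computable f \<longleftrightarrow> (\<exists>F. general_recursive 1 F \<and> (\<forall>n. f n = F [n]))"

definition odd_perfect_ratio_below :: "real \<Rightarrow> nat set" where
  "odd_perfect_ratio_below K = {N. odd N \<and> perfect N \<and>
     (\<exists>q \<alpha>. prime q \<and> \<alpha> \<ge> 1 \<and> exactly_divides q \<alpha> N \<and>
        real (sigma (N div q ^ \<alpha>)) / real (q ^ \<alpha>) < K)}"

end

theory Submission
  imports Defs "HOL-Number_Theory.Cong"
begin

text \<open>
  Write \<open>N = q\<^sup>\<alpha> n\<close>. Then \<open>\<sigma>(n) = k q\<^sup>\<alpha>\<close> and \<open>2 n = k \<sigma>(q\<^sup>\<alpha>)\<close> with \<open>k < K\<close> and \<open>q\<close> not dividing \<open>k\<close>.
  For each prime power \<open>p\<^sup>l\<close> exactly dividing \<open>n\<close> put \<open>\<sigma>(p\<^sup>l) = m q\<^sup>b\<close> with \<open>q\<close> not dividing \<open>m\<close>; the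
  product of the \<open>m\<close> is \<open>k\<close> and the sum of the \<open>b\<close> is \<open>\<alpha>\<close>.

  The components with \<open>m = 1\<close> have \<open>l \<ge> 2\<close>, and by lifting the exponent \<open>p\<^sup>l\<^sup>-\<^sup>1\<close> divides \<open>k (\<alpha> + 1)\<close>, so
  they contribute at most half of \<open>\<alpha>\<close> once \<open>q\<^sup>\<alpha>\<close> is large. There are fewer than \<open>K\<close> components with \<open>m \<ge> 2\<close>,
  so one of them has \<open>\<alpha> \<le> 2 K b\<close>. For it put \<open>c = m (1 - p)\<close>, so that \<open>c q\<^sup>b \<equiv> 1\<close> modulo \<open>p\<^sup>l\<close>, and
  divide: \<open>\<alpha> + 1 = a b + r\<close>, \<open>s = b - r\<close>. As \<open>k q\<^sup>\<alpha>\<^sup>+\<^sup>1 \<equiv> k\<close>, both \<open>k (q\<^sup>r - c\<^sup>a)\<close> and \<open>k (1 - q\<^sup>s c\<^sup>a\<^sup>+\<^sup>1)\<close>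
  vanish modulo \<open>p\<^sup>l\<close>. If \<open>p\<^sup>l\<close> is large, the powers of \<open>c\<close> have small representatives divisible by the
  same power of \<open>m\<close>, and one of the two congruences becomes an equality: \<open>q\<^sup>r\<close> is a multiple of \<open>m\<close>,
  or \<open>q\<^sup>s\<close> divides \<open>1\<close>. Both are impossible. So \<open>p\<^sup>l\<close>, hence \<open>q\<^sup>b\<close>, \<open>q\<^sup>\<alpha>\<close> and \<open>N\<close> are bounded.
\<close>

section \<open>Closure properties of computable functions\<close>

lemma computable_const: "computable (\<lambda>_. c)"
proof -
  have "\<exists>F. general_recursive 1 F \<and> (\<forall>xs. F xs = c)"
  proof (induction c)
    case 0
    show ?case using general_recursive.zero by blast
  next
    case (Suc c)
    then obtain F where F: "general_recursive 1 F" "\<forall>xs. F xs = c" by blast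
    have "general_recursive (length [F]) (\<lambda>xs. Suc (hd xs))" using general_recursive.succ by simp
    from general_recursive.comp[OF this, of 1] F show ?case by auto
  qed
  then show ?thesis unfolding computable_def by metis
qed

lemma computable_id: "computable (\<lambda>x. x)"
  unfolding computable_def using general_recursive.proj[of 0 1] by (intro exI conjI) auto

lemma computable_binary:
  assumes G: "general_recursive 2 G" and f: "computable f" and g: "computable g"
  shows "computable (\<lambda>n. G [f n, g n])"
proof -
  obtain F F' where F: "general_recursive 1 F" "\<And>n. f n = F [n]" "general_recursive 1 F'" "\<And>n. g n = F' [n]"
    using f g unfolding computable_def by blast
  have "general_recursive (length [F, F']) G" using G by (simp add: numeral_2_eq_2)
  from general_recursive.comp[OF this, of 1] F(1,3)
  have "general_recursive 1 (\<lambda>xs. G [F xs, F' xs])" by simp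
  then show ?thesis unfolding computable_def F by blast
qed

text \<open>Addition, multiplication and powers each iterate a map of the accumulated value and one
  fixed argument, so the step function discards the counter. Recursion runs on the head of the list,
  which is why the exponent comes first in \<open>general_recursive_power\<close>.\<close>

lemma general_recursive_binary_rec:
  assumes f: "general_recursive 1 f" and g: "general_recursive 2 g"
  shows "general_recursive 2 (\<lambda>xs. rec_nat (f (tl xs)) (\<lambda>y r. g [r, tl xs ! 0]) (hd xs))"
proof -
  let ?p = "\<lambda>i xs. xs ! i :: nat"
  have "general_recursive (length [?p 1, ?p 2]) g" using g by (simp add: numeral_2_eq_2)
  from general_recursive.comp[OF this, of 3]
  have "general_recursive 3 (\<lambda>xs. g [xs ! 1, xs ! 2])"
    by (simp add: general_recursive.proj)
  then have "general_recursive (Suc (Suc 1)) (\<lambda>xs. g [xs ! 1, xs ! 2])"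
    by (simp add: numeral_3_eq_3)
  from general_recursive.prim_rec[OF f this]
  show ?thesis by (simp add: numeral_2_eq_2)
qed

lemma general_recursive_add: "\<exists>G. general_recursive 2 G \<and> (\<forall>x y. G [x, y] = x + y)"
proof -
  have "general_recursive 2 (\<lambda>xs. xs ! 0)" by (rule general_recursive.proj) simp
  then have "general_recursive 2 (\<lambda>xs. Suc (xs ! 0))"
    using general_recursive.comp[of "[\<lambda>xs. xs ! 0]" "\<lambda>xs. Suc (hd xs)" 2] general_recursive.succ by simp
  from general_recursive_binary_rec[OF general_recursive.proj[of 0 1] this]
  have "general_recursive 2 (\<lambda>xs. rec_nat (tl xs ! 0) (\<lambda>y. Suc) (hd xs))" by simp
  moreover have "rec_nat y (\<lambda>y. Suc) x = x + y" for x y by (induction x) auto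
  ultimately show ?thesis by (intro exI conjI) auto
qed

lemma general_recursive_mult: "\<exists>G. general_recursive 2 G \<and> (\<forall>x y. G [x, y] = x * y)"
proof -
  obtain A where A: "general_recursive 2 A" "\<And>x y. A [x, y] = x + y"
    using general_recursive_add by blast
  have "general_recursive 2 (\<lambda>xs. rec_nat 0 (\<lambda>y r. r + tl xs ! 0) (hd xs))"
    using general_recursive_binary_rec[OF general_recursive.zero A(1)] by (simp add: A(2))
  moreover have "rec_nat 0 (\<lambda>_ r. r + y) x = x * y" for x y :: nat by (induction x) auto
  ultimately show ?thesis by (intro exI conjI) auto
qed

lemma general_recursive_power: "\<exists>G. general_recursive 2 G \<and> (\<forall>x y. G [x, y] = y ^ x)"
proof -
  obtain M where M: "general_recursive 2 M" "\<And>x y. M [x, y] = x * y"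
    using general_recursive_mult by blast
  have one: "general_recursive 1 (\<lambda>_. 1)"
    using general_recursive.comp[of "[\<lambda>_. 0]" "\<lambda>xs. Suc (hd xs)" 1]
      general_recursive.succ general_recursive.zero by simp
  have "general_recursive 2 (\<lambda>xs. rec_nat 1 (\<lambda>y r. r * tl xs ! 0) (hd xs))"
    using general_recursive_binary_rec[OF one M(1)] by (simp add: M(2))
  moreover have "rec_nat 1 (\<lambda>_ r. r * y) x = y ^ x" for x y :: nat by (induction x) auto
  ultimately show ?thesis by (intro exI conjI) auto
qed

lemma computable_add: "computable f \<Longrightarrow> computable g \<Longrightarrow> computable (\<lambda>n. f n + g n)"
  using general_recursive_add computable_binary by fastforce

lemma computable_mult: "computable f \<Longrightarrow> computable g \<Longrightarrow> computable (\<lambda>n. f n * g n)"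
  using general_recursive_mult computable_binary by fastforce

lemma computable_power: "computable f \<Longrightarrow> computable g \<Longrightarrow> computable (\<lambda>n. f n ^ g n)"
  using general_recursive_power computable_binary[of _ g f] by fastforce

section \<open>The sum of divisors and sums of powers\<close>

text \<open>Coprimality makes multiplication a bijection from pairs of divisors of \<open>a\<close>
  and \<open>b\<close> to divisors of \<open>a * b\<close>.\<close>

lemma sigma_mult:
  assumes "coprime a b" "a > 0" "b > 0"
  shows "sigma (a * b) = sigma a * sigma b"
proof -
  have inj: "inj_on (\<lambda>(d, e). d * e) ({d. d dvd a} \<times> {e. e dvd b})"
  proof (rule inj_onI, clarify)
    fix d e d' e'
    assume d: "d dvd a" "d' dvd a" and e: "e dvd b" "e' dvd b" and eq: "d * e = d' * e'"
    have "coprime d e'" "coprime d' e"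
      using assms(1) d e by (meson coprime_divisors)+
    then have "d dvd d'" "d' dvd d" "e dvd e'" "e' dvd e"
      using eq by (metis coprime_commute coprime_dvd_mult_left_iff coprime_dvd_mult_right_iff dvd_triv_left dvd_triv_right)+
    then show "d = d' \<and> e = e'" by (simp add: dvd_antisym)
  qed
  have "d \<in> (\<lambda>(d, e). d * e) ` ({d. d dvd a} \<times> {e. e dvd b})" if "d dvd a * b" for d
    using that by (elim dvd_productE) auto
  then have img: "{d. d dvd a * b} = (\<lambda>(d, e). d * e) ` ({d. d dvd a} \<times> {e. e dvd b})"
    by (auto intro: mult_dvd_mono)
  have "sigma (a * b) = (\<Sum>(d, e)\<in>{d. d dvd a} \<times> {e. e dvd b}. d * e)"
    unfolding sigma_def img sum.reindex[OF inj] by (simp add: o_def case_prod_unfold)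
  also have "\<dots> = sigma a * sigma b"
    by (simp add: sigma_def sum_product sum.cartesian_product)
  finally show ?thesis .
qed

lemma sigma_prime_power:
  assumes "prime p"
  shows "sigma (p ^ l) = (\<Sum>i\<le>l. p ^ i)"
proof -
  have "inj_on (\<lambda>i. p ^ i) {..l}"
    using prime_gt_1_nat[OF assms] by (auto intro: inj_onI simp: power_inject_exp)
  moreover have "{d. d dvd p ^ l} = (\<lambda>i. p ^ i) ` {..l}"
    using assms by (auto simp: divides_primepow_nat)
  ultimately show ?thesis by (simp add: sigma_def sum.reindex)
qed

lemma sigma_prod_prime_powers:
  assumes "finite A" "\<And>p. p \<in> A \<Longrightarrow> prime p"
  shows "sigma (\<Prod>p\<in>A. p ^ f p) = (\<Prod>p\<in>A. sigma (p ^ f p))"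
  using assms
proof (induction A rule: finite_induct)
  case empty
  show ?case by (simp add: sigma_def)
next
  case (insert p A)
  have "coprime (p ^ f p) (\<Prod>p\<in>A. p ^ f p)"
    using insert by (intro prod_coprime_right) (auto intro!: primes_coprime)
  then show ?case using insert
    by (simp add: sigma_mult prime_gt_0_nat prod_pos)
qed

lemma sigma_prime_factors:
  assumes "n > 0"
  shows "sigma n = (\<Prod>p\<in>prime_factors n. sigma (p ^ multiplicity p n))"
  using sigma_prod_prime_powers[of "prime_factors n" "\<lambda>p. multiplicity p n"] assms
  by (simp add: prime_factorization_nat[symmetric] in_prime_factors_imp_prime)

section \<open>Geometric sums and lifting the exponent at odd primes\<close>

lemma sum_powers_add:
  fixes x :: "'a :: comm_semiring_1"
  shows "(\<Sum>i<m + n. x ^ i) = (\<Sum>i<m. x ^ i) + x ^ m * (\<Sum>i<n. x ^ i)"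
  by (induction n) (simp_all add: power_add algebra_simps)

lemma sum_powers_mult:
  fixes x :: "'a :: comm_semiring_1"
  shows "(\<Sum>i<m * n. x ^ i) = (\<Sum>i<m. x ^ i) * (\<Sum>j<n. (x ^ m) ^ j)"
proof (induction n)
  case (Suc n)
  have "(\<Sum>i<m * Suc n. x ^ i) = (\<Sum>i<m * n. x ^ i) + x ^ (m * n) * (\<Sum>i<m. x ^ i)"
    by (metis add.commute mult_Suc_right sum_powers_add)
  then show ?case using Suc
    by (simp add: power_mult algebra_simps)
qed simp

text \<open>Expand \<open>Q = 1 + p * t\<close> to first order. Since \<open>p = 2 * h + 1\<close>,
  the indices below \<open>p\<close> add up to \<open>p * h\<close>, so the linear terms contribute
  a multiple of \<open>p ^ 2\<close>. This is where oddness enters: \<open>1 + 3\<close> is not 2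
  modulo 4.\<close>

lemma sum_powers_cong_prime_square:
  fixes Q p :: nat
  assumes p: "odd p" and Q: "[Q = 1] (mod p)" "Q \<ge> 1"
  shows "[(\<Sum>i<p. Q ^ i) = p] (mod p ^ 2)"
proof -
  obtain t where t: "Q = 1 + p * t"
    using Q by (metis cong_altdef_nat' cong_sym dvdE le_add_diff_inverse cong_altdef_nat)
  have pow: "[Q ^ i = 1 + i * (p * t)] (mod p ^ 2)" for i
  proof (induction i)
    case (Suc i)
    have "[Q ^ Suc i = (1 + p * t) * (1 + i * (p * t))] (mod p ^ 2)"
      using Suc unfolding power_Suc t by (rule cong_scalar_left)
    also have "(1 + p * t) * (1 + i * (p * t)) = 1 + Suc i * (p * t) + p ^ 2 * (i * t ^ 2)"
      by (simp add: algebra_simps power2_eq_square)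
    also have "[\<dots> = 1 + Suc i * (p * t)] (mod p ^ 2)"
      by (simp add: cong_def)
    finally show ?case .
  qed simp
  obtain h where h: "p = 2 * h + 1" using p by (elim oddE)
  have gauss: "(\<Sum>i<2 * h + 1. i) = (2 * h + 1) * h" for h :: nat
    by (induction h) (simp_all add: algebra_simps)
  have "[(\<Sum>i<p. Q ^ i) = (\<Sum>i<p. 1 + i * (p * t))] (mod p ^ 2)"
    by (intro cong_sum pow)
  also have "(\<Sum>i<p. 1 + i * (p * t)) = p + (\<Sum>i<p. i) * (p * t)"
    by (simp only: sum.distrib sum_distrib_right) simp
  also have "(\<Sum>i<p. i) = p * h" using gauss[of h] h by simp
  also have "p + p * h * (p * t) = p + p ^ 2 * (h * t)"
    by (simp add: algebra_simps power2_eq_square)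
  also have "[\<dots> = p] (mod p ^ 2)" by (simp add: cong_def)
  finally show ?thesis .
qed

text \<open>Lifting the exponent, by stripping factors \<open>p\<close> from \<open>n\<close>. If
  \<open>p\<close> does not divide \<open>n\<close>, the sum is \<open>n\<close> modulo
  \<open>p\<close> and hence prime to \<open>p\<close>. Otherwise it splits into a sum of
  \<open>p\<close> terms, divisible by \<open>p\<close> exactly once, and a sum of
  \<open>n div p\<close> powers of \<open>Q ^ p\<close>. The factor \<open>k\<close> is carried
  along because it may share factors with \<open>p\<close>.\<close>

lemma prime_power_dvd_sum_powers:
  fixes Q p k n :: nat
  assumes p: "prime p" "odd p" and "[Q = 1] (mod p)" "Q \<ge> 1" "p ^ j dvd k * (\<Sum>i<n. Q ^ i)"
  shows "p ^ j dvd k * n"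
  using assms(3-)
proof (induction n arbitrary: Q j rule: less_induct)
  case (less n)
  have Qp: "[Q ^ i = 1] (mod p)" for i using cong_pow[OF less.prems(1), of i] by simp
  show ?case
  proof (cases "p dvd n")
    case False
    have "[(\<Sum>i<n. Q ^ i) = (\<Sum>i<n. 1)] (mod p)" by (intro cong_sum Qp)
    then have "\<not> p dvd (\<Sum>i<n. Q ^ i)" using False by (simp add: cong_dvd_iff)
    then have "coprime (p ^ j) (\<Sum>i<n. Q ^ i)" using p by (simp add: prime_imp_coprime)
    then have "p ^ j dvd k" using less.prems(3) by (simp add: coprime_dvd_mult_left_iff)
    then show ?thesis by simp
  next
    case True
    then obtain n' where n': "n = p * n'" by blast
    show ?thesis
    proof (cases "j = 0 \<or> n = 0")
      case False
      then obtain i where j: "j = Suc i" using not0_implies_Suc by blast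
      have "[(\<Sum>i<p. Q ^ i) = p] (mod p ^ 2)"
        using p less.prems by (intro sum_powers_cong_prime_square) auto
      then have eq: "(\<Sum>i<p. Q ^ i) mod p ^ 2 = p mod p ^ 2" by (simp add: cong_def)
      have p1: "p > 1" using p prime_gt_1_nat by blast
      have "p dvd (\<Sum>i<p. Q ^ i)"
        using eq by (metis dvd_mod_iff dvd_power dvd_refl pos2)
      then obtain w where w: "(\<Sum>i<p. Q ^ i) = p * w" by blast
      have "\<not> p dvd w"
      proof
        assume "p dvd w"
        then have "p ^ 2 dvd p" using eq unfolding w
          by (metis dvd_imp_mod_0 mod_eq_0_iff_dvd mult_dvd_mono dvd_refl power2_eq_square)
        then show False using p1 by (auto simp: power2_eq_square dest!: dvd_imp_le)
      qed
      then have cop: "coprime (p ^ i) w" using p by (simp add: prime_imp_coprime)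
      have "p * p ^ i dvd p * (w * (k * (\<Sum>j<n'. (Q ^ p) ^ j)))"
        using less.prems(3) unfolding n' sum_powers_mult w j by (simp add: mult_ac)
      then have "p ^ i dvd w * (k * (\<Sum>j<n'. (Q ^ p) ^ j))" using p1 by simp
      then have "p ^ i dvd k * (\<Sum>j<n'. (Q ^ p) ^ j)"
        using cop by (simp add: coprime_dvd_mult_right_iff)
      then have "p ^ i dvd k * n'"
        using False n' p1 less.prems(2) Qp by (intro less.IH[of n' "Q ^ p"]) auto
      then show ?thesis by (simp add: j n' mult.left_commute[of k])
    qed auto
  qed
qed

text \<open>If \<open>l = 1\<close>, then \<open>p + 1 = q ^ b\<close> contradicts parity. For the
  divisibility, \<open>q\<close> need not be 1 modulo \<open>p\<close>, but \<open>q ^ b\<close> is,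
  and \<open>q ^ b - 1 = p * w\<close> contains \<open>p\<close> exactly once. Passing from
  \<open>q\<close> to \<open>q ^ b\<close> therefore costs a single factor \<open>p\<close>, and
  lifting the exponent applies to \<open>q ^ b\<close>.\<close>

lemma unit_component:
  fixes p q k n b l :: nat
  assumes p: "prime p" "odd p" and q: "odd q" and l: "l \<ge> 1"
    and sg: "(\<Sum>i\<le>l. p ^ i) = q ^ b" and dv: "p ^ l dvd k * (\<Sum>i<n. q ^ i)"
  shows "l \<ge> 2" "p ^ (l - 1) dvd k * n"
proof -
  have "odd (q ^ b)" using q by simp
  moreover have "Suc p = q ^ b" if "l = 1" using sg that by simp
  ultimately have "even p" if "l = 1" using that by (metis even_Suc)
  then have "l \<noteq> 1" using p by blast
  then show "l \<ge> 2" using l by simp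
  define w where "w = (\<Sum>i<l. p ^ i)"
  have Q: "q ^ b = 1 + p * w"
    unfolding sg[symmetric] w_def sum_distrib_left
    by (simp add: lessThan_Suc_atMost[symmetric] sum.lessThan_Suc_shift del: sum.lessThan_Suc)
  obtain l' where l': "l = Suc l'" using l by (cases l) auto
  have "w = 1 + p * (\<Sum>i<l'. p ^ i)"
    unfolding w_def l' by (simp add: sum.lessThan_Suc_shift sum_distrib_left del: sum.lessThan_Suc)
  then have "\<not> p dvd w" using p(1) by (metis dvd_add_left_iff dvd_triv_left not_prime_unit)
  then have cop: "coprime (p ^ l') w" using p by (simp add: prime_imp_coprime)
  have geo: "(q - 1) * (\<Sum>i<b. q ^ i) = p * w"
  proof -
    have "int ((q - 1) * (\<Sum>i<b. q ^ i)) = int (p * w)"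
      using power_diff_1_eq[of "int q" b] arg_cong[OF Q, of int] q
      by (cases q) auto
    then show ?thesis using of_nat_eq_iff by blast
  qed
  \<comment> \<open>Lengthen the sum from \<open>n\<close> to \<open>n * b\<close> terms, then
    regroup it into \<open>b\<close> powers of \<open>q\<close> times \<open>n\<close> powers of
    \<open>q ^ b\<close>.\<close>
  have "p ^ l dvd (q - 1) * (k * (\<Sum>i<n * b. q ^ i))"
    unfolding sum_powers_mult using dv by (metis dvd_mult dvd_mult2 mult.assoc)
  also have "\<dots> = k * ((q - 1) * (\<Sum>i<b. q ^ i)) * (\<Sum>j<n. (q ^ b) ^ j)"
    by (subst mult.commute[of n b]) (simp add: sum_powers_mult mult_ac)
  also have "\<dots> = p * (w * (k * (\<Sum>j<n. (q ^ b) ^ j)))"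
    unfolding geo by (simp add: mult_ac)
  finally have "p ^ l' dvd w * (k * (\<Sum>j<n. (q ^ b) ^ j))"
    using p by (simp add: l' prime_gt_0_nat)
  then have dv': "p ^ l' dvd k * (\<Sum>j<n. (q ^ b) ^ j)"
    using cop by (simp add: coprime_dvd_mult_right_iff)
  have "[q ^ b = 1] (mod p)" "1 \<le> q ^ b"
    unfolding Q cong_add_lcancel_0_nat by (simp_all add: cong_0_iff)
  then have "p ^ l' dvd k * n" by (rule prime_power_dvd_sum_powers[OF p _ _ dv'])
  then show "p ^ (l - 1) dvd k * n" by (simp add: l')
qed

section \<open>Auxiliary divisibility and growth facts\<close>

lemma prod_prime_powers_dvd:
  fixes x :: nat
  assumes "finite A" "\<And>p. p \<in> A \<Longrightarrow> prime p" "\<And>p. p \<in> A \<Longrightarrow> p ^ f p dvd x"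
  shows "(\<Prod>p\<in>A. p ^ f p) dvd x"
  using assms
proof (induction A rule: finite_induct)
  case (insert p A)
  have "coprime (p ^ f p) (\<Prod>p\<in>A. p ^ f p)"
    using insert by (intro prod_coprime_right) (auto intro!: primes_coprime)
  then show ?case using insert by (simp add: divides_mult)
qed simp

text \<open>The exponent 12 is 3 times 4: a cube from comparing \<open>q ^ b\<close> with
  \<open>p ^ (l - 1)\<close>, and a fourth power taken to push the share of the components with
  \<open>m = 1\<close> below one half.\<close>

lemma Suc_power_12_le: "(n + 1) ^ 12 \<le> 12 ^ 12 * (2 :: nat) ^ n"
proof -
  have "n + 1 \<le> 12 * (n div 12 + 1)" by simp
  also have "\<dots> \<le> 12 * 2 ^ (n div 12)"
    using less_exp[of "n div 12"] by (intro mult_le_mono2) (simp add: Suc_le_eq)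
  finally have "(n + 1) ^ 12 \<le> (12 * 2 ^ (n div 12)) ^ 12" by (rule power_mono) simp
  also have "\<dots> = 12 ^ 12 * 2 ^ (n div 12 * 12)" by (simp add: power_mult_distrib power_mult)
  also have "\<dots> \<le> 12 ^ 12 * 2 ^ n" by (intro mult_le_mono2 power_increasing) auto
  finally show ?thesis .
qed

lemma prime_power_decomposition_unique:
  fixes q :: nat
  assumes "prime q" "\<not> q dvd x" "\<not> q dvd y" "x * q ^ i = y * q ^ j"
  shows "x = y" "i = j"
proof -
  have "multiplicity q (z * q ^ e) = e" if "\<not> q dvd z" for z e
    using assms(1) that by (intro multiplicity_eqI) (auto simp: prime_gt_0_nat)
  then show ij: "i = j" using assms by metis
  then show "x = y" using assms by (auto simp: prime_gt_0_nat)
qed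

section \<open>Bounding a component with cofactor at least two\<close>

text \<open>
  For large \<open>p\<close> the witness is the binomial expansion truncated below \<open>p\<^sup>l\<close>; for small \<open>p\<close> it is
  \<open>(m (1 - p))\<^sup>e\<close> itself.
\<close>

lemma small_residue:
  fixes p l m e E K L :: nat
  assumes p: "p \<ge> 1" and l: "l \<ge> 1" and e: "e \<le> E" and m: "1 \<le> m" "m \<le> K" and L: "L \<ge> 1"
    and big: "L * (K * L * (2 * K) ^ E) ^ E < p ^ l"
  obtains T :: int where "int m ^ e dvd T" "[T = (int m * (1 - int p)) ^ e] (mod int p ^ l)"
    "int L * \<bar>T\<bar> < int p ^ l"
\<comment> \<open>Above this threshold a single factor \<open>p\<close> outweighs
  \<open>L * (2 * m) ^ e\<close>. Below it, \<open>m * p\<close> is at most the base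
  \<open>K * L * (2 * K) ^ E\<close> occurring in \<open>big\<close>.\<close>
proof (cases "L * (2 * K) ^ E < p")
  case True
  define t where "t j = int (e choose j) * (- int p) ^ j" for j
  define U where "U = (\<Sum>j\<in>{..e} \<inter> {..<l}. t j)"
  have "(1 - int p) ^ e = (\<Sum>j\<le>e. t j)"
    using binomial_ring[of "- int p" 1 e] by (simp add: t_def)
  also have "\<dots> = U + (\<Sum>j\<in>{..e} - {..<l}. t j)"
    unfolding U_def by (rule sum.Int_Diff) simp
  finally have split: "(1 - int p) ^ e - U = (\<Sum>j\<in>{..e} - {..<l}. t j)" by simp
  have "int p ^ l dvd t j" if "\<not> j < l" for j
  proof -
    have "int p ^ l dvd int p ^ j" using that by (intro le_imp_power_dvd) simp
    then show ?thesis by (auto simp: t_def power_minus[of "int p"])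
  qed
  then have "int p ^ l dvd (1 - int p) ^ e - U"
    unfolding split by (intro dvd_sum) auto
  then have c: "[U = (1 - int p) ^ e] (mod int p ^ l)"
    by (simp add: cong_iff_dvd_diff dvd_diff_commute)
  \<comment> \<open>Only exponents below \<open>l\<close> remain, so \<open>U\<close> is a full
    factor \<open>p\<close> short of the modulus, up to binomial coefficients of total at most
    \<open>2 ^ e\<close>.\<close>
  have "\<bar>U\<bar> \<le> (\<Sum>j\<in>{..e} \<inter> {..<l}. \<bar>t j\<bar>)" unfolding U_def by (rule sum_abs)
  also have "\<dots> \<le> (\<Sum>j\<in>{..e} \<inter> {..<l}. int (e choose j) * int p ^ (l - 1))"
  proof (rule sum_mono)
    fix j assume "j \<in> {..e} \<inter> {..<l}"
    then have "int p ^ j \<le> int p ^ (l - 1)" using p by (intro power_increasing) auto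
    then show "\<bar>t j\<bar> \<le> int (e choose j) * int p ^ (l - 1)"
      by (simp add: t_def abs_mult power_abs mult_left_mono)
  qed
  also have "\<dots> \<le> (\<Sum>j\<le>e. int (e choose j) * int p ^ (l - 1))"
    by (rule sum_mono2) auto
  also have "\<dots> = int (2 ^ e) * int p ^ (l - 1)"
    by (simp only: sum_distrib_right[symmetric] of_nat_sum[symmetric] choose_row_sum)
  finally have U: "\<bar>U\<bar> \<le> int (2 ^ e) * int p ^ (l - 1)" .
  have "(2 * m) ^ e \<le> (2 * K) ^ e" using m by (intro power_mono) auto
  also have "\<dots> \<le> (2 * K) ^ E" using m e by (intro power_increasing) auto
  finally have "L * (2 * m) ^ e < p" using True
    by (meson le_less_trans mult_le_mono2)
  then have "int L * (2 * int m) ^ e < int p"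
    by (metis of_nat_less_iff of_nat_mult of_nat_numeral of_nat_power)
  then have lt: "int L * (2 * int m) ^ e * int p ^ (l - 1) < int p * int p ^ (l - 1)"
    using p by (intro mult_strict_right_mono) auto
  have "int L * \<bar>int m ^ e * U\<bar> \<le> int L * (int m ^ e * (int (2 ^ e) * int p ^ (l - 1)))"
    using U by (simp add: abs_mult mult_left_mono)
  also have "\<dots> = int L * (2 * int m) ^ e * int p ^ (l - 1)"
    by (simp add: power_mult_distrib)
  also have "\<dots> < int p * int p ^ (l - 1)" by (rule lt)
  also have "\<dots> = int p ^ l" using l by (cases l) auto
  finally have "int L * \<bar>int m ^ e * U\<bar> < int p ^ l" .
  moreover have "[int m ^ e * U = (int m * (1 - int p)) ^ e] (mod int p ^ l)"
    unfolding power_mult_distrib by (intro cong_mult c) simp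
  ultimately show ?thesis using that[of "int m ^ e * U"] by simp
next
  case False
  define T where "T = (int m * (1 - int p)) ^ e"
  have mp: "m * p \<le> K * L * (2 * K) ^ E"
    using mult_le_mono[of m K p "L * (2 * K) ^ E"] m False by (simp add: mult.assoc)
  have "\<bar>int m * (1 - int p)\<bar> \<le> int (m * p)"
    using p m by (simp add: abs_mult mult_left_mono)
  then have "\<bar>T\<bar> \<le> int (m * p) ^ e"
    unfolding T_def power_abs by (intro power_mono) auto
  also have "\<dots> \<le> int (m * p) ^ E" using e m p
    by (intro power_increasing) (auto simp flip: of_nat_mult simp: Suc_le_eq)
  also have "\<dots> \<le> int (K * L * (2 * K) ^ E) ^ E"
    using mp by (intro power_mono) (simp_all only: of_nat_le_iff of_nat_0_le_iff)
  finally have "int L * \<bar>T\<bar> \<le> int L * int (K * L * (2 * K) ^ E) ^ E"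
    by (simp add: mult_left_mono)
  also have "\<dots> < int p ^ l"
    using big by (metis of_nat_less_iff of_nat_mult of_nat_power)
  finally show ?thesis using that[of T] by (simp add: T_def power_mult_distrib)
qed

text \<open>The left side of \<open>big\<close> in \<open>small_residue\<close> for
  \<open>E = 4 * K + 1\<close> and \<open>L = 8 * K ^ 2\<close>. The exponents needed are
  \<open>a\<close> and \<open>a + 1\<close> with \<open>a\<close> at most \<open>4 * K\<close>; the
  margin \<open>L\<close> is twice the product of the bounds \<open>K\<close> for \<open>k\<close>
  and \<open>4 * K\<close> for \<open>q ^ s\<close>.\<close>

definition component_bound :: "nat \<Rightarrow> nat" where
  "component_bound K = 8 * K ^ 2 * (K * (8 * K ^ 2) * (2 * K) ^ (4 * K + 1)) ^ (4 * K + 1)"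

lemma sum_power_lt:
  fixes p :: nat
  assumes "p \<ge> 2"
  shows "(\<Sum>i\<le>l. p ^ i) < 2 * p ^ l"
proof (induction l)
  case (Suc l)
  then have "(\<Sum>i\<le>Suc l. p ^ i) < 2 * p ^ l + p ^ Suc l" by simp
  also have "2 * p ^ l \<le> p ^ Suc l" using assms by simp
  finally show ?case by simp
qed simp

lemma eq_of_cong_small:
  fixes x y M :: int
  assumes "[x = y] (mod M)" "\<bar>x\<bar> + \<bar>y\<bar> < M"
  shows "x = y"
proof (rule ccontr)
  assume "x \<noteq> y"
  with assms(1) have "M \<le> \<bar>x - y\<bar>" using dvd_imp_le_int[of "x - y" M] by (auto simp: cong_iff_dvd_diff)
  then show False using assms(2) by linarith
qed

lemma component_bounded:
  fixes p q m k K b n l :: nat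
  assumes q: "prime q" and p: "prime p" and l: "l \<ge> 1"
    and sg: "(\<Sum>i\<le>l. p ^ i) = m * q ^ b" and qm: "\<not> q dvd m" and m: "2 \<le> m" "m \<le> K"
    and k: "1 \<le> k" "k \<le> K" and dv: "[int k * int q ^ n = int k] (mod int p ^ l)"
    and bn: "1 \<le> b" "b \<le> n" "n \<le> 4 * K * b"
  shows "p ^ l \<le> component_bound K"
proof (rule ccontr)
  assume "\<not> ?thesis"
  then have big: "8 * K ^ 2 * (K * (8 * K ^ 2) * (2 * K) ^ (4 * K + 1)) ^ (4 * K + 1) < p ^ l"
    by (simp add: component_bound_def)
  have p2: "p \<ge> 2" and q2: "q \<ge> 2" using p q by (simp_all add: prime_ge_2_nat)
  have K: "K \<ge> 2" using m by simp
  define c where "c = int m * (1 - int p)"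
  define P where "P = int p ^ l"
  define a r where "a = n div b" and "r = n mod b"
  define s where "s = b - r"
  have n: "n = a * b + r" and r: "r < b" using bn by (simp_all add: a_def r_def)
  have s: "s \<ge> 1" "b = r + s" using r by (simp_all add: s_def)
  have "n div b \<le> 4 * K * b div b" using bn(3) by (rule div_le_mono)
  then have a: "1 \<le> a" "a \<le> 4 * K"
    using bn by (simp_all add: a_def Suc_le_eq div_greater_zero_iff)
  have "c * int q ^ b = (1 - int p) * (\<Sum>i\<le>l. int p ^ i)"
    using arg_cong[OF sg, of int] by (simp add: c_def)
  also have "\<dots> = 1 - int p ^ Suc l"
    unfolding one_diff_power_eq[of "int p" "Suc l"] lessThan_Suc_atMost ..
  finally have "[c * int q ^ b = 1] (mod P)"
    by (simp add: cong_iff_dvd_diff P_def)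
  then have cq: "[(c * int q ^ b) ^ e = 1] (mod P)" for e
    using cong_pow by fastforce
  have dv': "[int k * int q ^ n = int k] (mod P)" using dv by (simp add: P_def)
  \<comment> \<open>Multiply \<open>k\<close> = \<open>k * q ^ n\<close> by \<open>c ^ a\<close>,
    which cancels the part \<open>q ^ (a * b)\<close> of \<open>q ^ n\<close>. The factor
    \<open>k\<close> stays since it need not be invertible modulo \<open>P\<close>.\<close>
  have ca: "[int k * c ^ a = int k * int q ^ r] (mod P)"
  proof -
    have "[int k * c ^ a = int k * int q ^ n * c ^ a] (mod P)"
      by (intro cong_mult cong_sym[OF dv']) simp_all
    also have "int k * int q ^ n * c ^ a = int k * int q ^ r * (c * int q ^ b) ^ a"
      by (simp add: n power_add power_mult_distrib power_mult[symmetric] mult_ac)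
    also have "[\<dots> = int k * int q ^ r * 1] (mod P)" by (intro cong_mult cq) simp_all
    finally show ?thesis by simp
  qed
  \<comment> \<open>Here \<open>s\<close> completes the exponent:
    \<open>n + s = (a + 1) * b\<close>, so every power of \<open>q\<close> cancels.\<close>
  have ca': "[int k * int q ^ s * c ^ (a + 1) = int k] (mod P)"
  proof -
    have "[int k * (int q ^ s * c ^ (a + 1)) = int k * int q ^ n * (int q ^ s * c ^ (a + 1))] (mod P)"
      by (intro cong_mult cong_sym[OF dv']) simp_all
    also have "int k * int q ^ n * (int q ^ s * c ^ (a + 1)) = int k * (c * int q ^ b) ^ (a + 1)"
      by (simp add: n s(2) power_add power_mult_distrib power_mult[symmetric] algebra_simps)
    also have "[\<dots> = int k * 1] (mod P)" by (intro cong_mult cq) simp_all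
    finally show ?thesis by (simp add: mult_ac)
  qed
  have ex: "\<exists>T. int m ^ e dvd T \<and> [T = c ^ e] (mod P) \<and> int (8 * K ^ 2) * \<bar>T\<bar> < P"
    if "e \<le> 4 * K + 1" for e
    proof -
    have "1 \<le> p" "1 \<le> m" "1 \<le> 8 * K ^ 2" using p2 m K by (simp_all add: Suc_le_eq)
    from small_residue[OF this(1) l that this(2) m(2) this(3) big]
    show ?thesis unfolding c_def P_def by blast
  qed
  have kK: "int k \<le> int K" using k by simp
  \<comment> \<open>In the second case below, the lone term \<open>k\<close> must also fit under
    \<open>P\<close>; this comes from \<open>8 * K ^ 2 < P\<close>.\<close>
  have "0 < (K * (8 * K ^ 2) * (2 * K) ^ (4 * K + 1)) ^ (4 * K + 1)"
    using K by (intro zero_less_power mult_pos_pos) auto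
  then have "8 * K ^ 2 \<le> 8 * K ^ 2 * (K * (8 * K ^ 2) * (2 * K) ^ (4 * K + 1)) ^ (4 * K + 1)"
    by (metis One_nat_def Suc_le_eq mult.right_neutral mult_le_mono2)
  from le_less_trans[OF this big] have "int (8 * K ^ 2) < P"
    unfolding P_def of_nat_power[symmetric] of_nat_less_iff .
  then have P: "8 * int K ^ 2 < P" by simp
  have KK: "int K \<le> int K ^ 2" using K by (simp add: power2_eq_square)
  have "2 * q ^ b \<le> m * q ^ b" using m by simp
  also have "\<dots> < 2 * p ^ l" using sum_power_lt[OF p2, of l] sg by simp
  finally have "q ^ b < p ^ l" by simp
  then have qb: "int q ^ r * int q ^ s < P"
    unfolding P_def s(2) power_add[symmetric] by (metis of_nat_less_iff of_nat_power)
  show False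
  \<comment> \<open>As \<open>q ^ r * q ^ s < P\<close>, a large \<open>q ^ s\<close> leaves room
    for the factor \<open>4 * k\<close> next to \<open>q ^ r\<close>, and the congruence
    \<open>ca\<close> becomes an equality. A small \<open>q ^ s\<close> is itself a bounded
    multiplier, and \<open>ca'\<close> becomes one.\<close>
  proof (cases "4 * K \<le> q ^ s")
    case True
    from ex[of a] a obtain T where T: "int m ^ a dvd T" "[T = c ^ a] (mod P)" "int (8 * K ^ 2) * \<bar>T\<bar> < P"
      by auto
    have "4 * int K \<le> int q ^ s" using True by (simp flip: of_nat_power of_nat_le_iff)
    then have "int q ^ r * (4 * int K) \<le> int q ^ r * int q ^ s" by (intro mult_left_mono) auto
    moreover have "int k * int q ^ r \<le> int K * int q ^ r" using kK by (intro mult_right_mono) auto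
    ultimately have 1: "4 * (int k * int q ^ r) < P" using qb by (simp add: mult_ac)
    have "int k * \<bar>T\<bar> \<le> int K ^ 2 * \<bar>T\<bar>" using kK KK by (intro mult_right_mono) auto
    then have 2: "8 * (int k * \<bar>T\<bar>) < P" using T(3) by simp
    have "[int k * T = int k * int q ^ r] (mod P)"
      using cong_trans[OF cong_mult[OF cong_refl T(2)] ca] .
    moreover have "\<bar>int k * T\<bar> + \<bar>int k * int q ^ r\<bar> < P"
    proof -
      have "0 \<le> int k * \<bar>T\<bar>" "0 \<le> int k * int q ^ r" by simp_all
      then show ?thesis using 1 2 unfolding abs_mult abs_of_nat power_abs by linarith
    qed
    ultimately have "int k * T = int k * int q ^ r" by (rule eq_of_cong_small)
    then have "T = int q ^ r" using k by simp
    with T(1) have "m ^ a dvd q ^ r"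
      by (metis of_nat_dvd_iff of_nat_power)
    then have "m dvd q ^ r" using a dvd_trans[OF dvd_power[of a m]] by auto
    moreover have "coprime (q ^ r) m" using q qm by (simp add: prime_imp_coprime)
    ultimately have "is_unit m" by (metis coprime_absorb_right)
    then show False using m by simp
  next
    case False
    from ex[of "a + 1"] a obtain T where T: "[T = c ^ (a + 1)] (mod P)" "int (8 * K ^ 2) * \<bar>T\<bar> < P"
      by auto
    have "int q ^ s \<le> 4 * int K" using False by (metis nat_le_linear of_nat_le_iff of_nat_mult of_nat_numeral of_nat_power)
    then have "int k * int q ^ s \<le> int K * (4 * int K)" using kK by (intro mult_mono) auto
    then have "int k * int q ^ s * \<bar>T\<bar> \<le> int K * (4 * int K) * \<bar>T\<bar>" by (intro mult_right_mono) auto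
    then have 1: "2 * (int k * int q ^ s * \<bar>T\<bar>) < P" using T(2) by (simp add: power2_eq_square)
    have "[int k * int q ^ s * T = int k] (mod P)"
      using cong_trans[OF cong_mult[OF cong_refl T(1)] ca'] .
    moreover have "\<bar>int k * int q ^ s * T\<bar> + \<bar>int k\<bar> < P"
    proof -
      have "0 \<le> int k * int q ^ s * \<bar>T\<bar>" by simp
      then show ?thesis using 1 P KK kK unfolding abs_mult abs_of_nat power_abs by linarith
    qed
    ultimately have "int k * int q ^ s * T = int k" by (rule eq_of_cong_small)
    then have "int q ^ s * T = 1" using k by simp
    then have "int q ^ s dvd 1" by (metis dvd_triv_left)
    moreover have "int q dvd int q ^ s" using s(1) by (intro dvd_power) auto
    ultimately have "int q dvd 1" by (rule dvd_trans[rotated])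
    then show False using q2 by simp
  qed
qed

section \<open>The bound for odd perfect numbers\<close>

text \<open>The parenthesis bounds \<open>q ^ \<alpha>\<close>: its first summand is the size up to
  which nothing needs proof, its second covers larger values. The outer form reflects
  \<open>N = q ^ \<alpha> * n\<close> with \<open>n\<close> at most \<open>K * q ^ \<alpha>\<close>.
  A sum in place of a maximum keeps everything within sums, products and powers, whose computability
  is established above.\<close>

definition odd_perfect_bound :: "nat \<Rightarrow> nat" where
  "odd_perfect_bound K = K * (12 ^ 12 * K ^ 12 + component_bound K ^ (4 * K)) ^ 2"

lemma odd_perfect_le:
  assumes N: "odd N" "perfect N" and q: "prime q" and al: "\<alpha> \<ge> 1"
    and ex: "exactly_divides q \<alpha> N" and le: "sigma (N div q ^ \<alpha>) \<le> K * q ^ \<alpha>"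
  shows "N \<le> odd_perfect_bound K"
proof -
  define n where "n = N div q ^ \<alpha>"
  have Nn: "N = q ^ \<alpha> * n" using ex by (simp add: n_def exactly_divides_def)
  have N0: "N > 0" using N by (simp add: perfect_def)
  then have n0: "n > 0" using Nn by (cases n) auto
  have qn: "\<not> q dvd n" using ex by (auto simp: exactly_divides_def Nn mult_dvd_mono)
  have oq: "odd q" and on: "odd n" using N(1) al unfolding Nn by auto
  have q0: "q > 0" and q2: "q \<ge> 2" using q by (simp_all add: prime_gt_0_nat prime_ge_2_nat)
  define G where "G = (\<Sum>i<Suc \<alpha>. q ^ i)"
  have sG: "sigma (q ^ \<alpha>) = G" by (simp add: sigma_prime_power[OF q] G_def lessThan_Suc_atMost)
  have "coprime (q ^ \<alpha>) n" using q qn by (simp add: prime_imp_coprime)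
  then have eq: "G * sigma n = 2 * (q ^ \<alpha> * n)"
    using N(2) n0 q0 by (simp add: perfect_def Nn sigma_mult sG)
  have "G = 1 + q * (\<Sum>i<\<alpha>. q ^ i)"
    unfolding G_def by (simp add: sum.lessThan_Suc_shift sum_distrib_left del: sum.lessThan_Suc)
  then have "\<not> q dvd G" using q by (metis dvd_add_left_iff dvd_triv_left not_prime_unit)
  then have "coprime (q ^ \<alpha>) G" using q by (simp add: prime_imp_coprime)
  moreover have "q ^ \<alpha> dvd G * sigma n" unfolding eq by simp
  ultimately have "q ^ \<alpha> dvd sigma n" by (simp add: coprime_dvd_mult_right_iff)
  then obtain k where k: "sigma n = k * q ^ \<alpha>" by (metis dvdE mult.commute)
  have kG: "k * G = 2 * n" using eq q0 by (simp add: k mult.commute[of k])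
  have k0: "k \<ge> 1" using kG n0 by (cases k) auto
  have kK: "k \<le> K" using le q0 by (simp add: k flip: n_def)
  have qk: "\<not> q dvd k"
  proof
    assume "q dvd k"
    then have "q dvd 2 * n" using kG by (metis dvd_mult2)
    then have "q dvd 2" using q qn by (simp add: prime_dvd_mult_iff)
    then show False using oq q2 by (auto dest: dvd_imp_le)
  qed

  define F where "F = prime_factors n"
  define l where "l p = multiplicity p n" for p
  define b where "b p = multiplicity q (sigma (p ^ l p))" for p
  define m where "m p = sigma (p ^ l p) div q ^ b p" for p
  have F: "prime p" "odd p" "l p \<ge> 1" "p ^ l p dvd k * G" if "p \<in> F" for p
  proof -
    show "prime p" using that by (auto simp: F_def)
    have "p dvd n" using that by (auto simp: F_def)
    then show "odd p" using on by (meson dvd_trans)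
    show "l p \<ge> 1" using that by (simp add: F_def l_def prime_factors_multiplicity)
    show "p ^ l p dvd k * G" unfolding kG l_def by (simp add: multiplicity_dvd)
  qed
  have finF: "finite F" by (simp add: F_def)
  have sg: "sigma (p ^ l p) = m p * q ^ b p" "\<not> q dvd m p" "m p \<ge> 1"
    "(\<Sum>i\<le>l p. p ^ i) = m p * q ^ b p" if p: "p \<in> F" for p
  proof -
    show 1: "sigma (p ^ l p) = m p * q ^ b p" by (simp add: m_def b_def multiplicity_dvd)
    then show "(\<Sum>i\<le>l p. p ^ i) = m p * q ^ b p"
      using sigma_prime_power[OF F(1)[OF p], of "l p"] by simp
    moreover have "(\<Sum>i\<le>l p. p ^ i) \<ge> (\<Sum>i\<in>{0}. p ^ i)" by (intro sum_mono2) auto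
    ultimately have "m p * q ^ b p > 0" by (simp add: q0)
    then show "m p \<ge> 1" by simp
    have "sigma (p ^ l p) \<noteq> 0" using \<open>m p * q ^ b p > 0\<close> 1 by simp
    then show "\<not> q dvd m p" unfolding m_def b_def
      using q by (intro multiplicity_decompose) (auto simp: prime_gt_1_nat)
  qed
  have "k * q ^ \<alpha> = (\<Prod>p\<in>F. m p * q ^ b p)"
    unfolding k[symmetric] sigma_prime_factors[OF n0] F_def[symmetric] l_def[symmetric]
    using sg by (intro prod.cong) auto
  also have "\<dots> = (\<Prod>p\<in>F. m p) * q ^ (\<Sum>p\<in>F. b p)" by (simp add: prod.distrib power_sum)
  finally have keq: "k * q ^ \<alpha> = (\<Prod>p\<in>F. m p) * q ^ (\<Sum>p\<in>F. b p)" .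
  have "\<not> q dvd (\<Prod>p\<in>F. m p)" using q finF sg by (simp add: prime_dvd_prod_iff)
  from prime_power_decomposition_unique[OF q qk this keq]
  have km: "k = (\<Prod>p\<in>F. m p)" and ab: "\<alpha> = (\<Sum>p\<in>F. b p)" by simp_all

  have "q ^ \<alpha> \<le> 12 ^ 12 * K ^ 12 + component_bound K ^ (4 * K)"
  proof (cases "q ^ \<alpha> \<le> 12 ^ 12 * K ^ 12")
    case False
    define S R where "S = {p \<in> F. m p = 1}" and "R = {p \<in> F. m p \<ge> 2}"
    have FSR: "F = S \<union> R" "S \<inter> R = {}" "finite S" "finite R"
      using sg finF by (force simp: S_def R_def)+
    have S: "2 \<le> l p" "p ^ (l p - 1) dvd k * Suc \<alpha>" if "p \<in> S" for p
      using unit_component[of p q "l p" "b p" k "Suc \<alpha>"] that F sg oq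
      by (auto simp: S_def G_def simp del: sum.lessThan_Suc)
    have "q ^ (\<Sum>p\<in>S. b p) = (\<Prod>p\<in>S. q ^ b p)" by (rule power_sum)
    also have "\<dots> \<le> (\<Prod>p\<in>S. (p ^ (l p - 1)) ^ 3)"
    proof (rule prod_mono, safe)
      fix p assume p: "p \<in> S"
      then have pF: "p \<in> F" "m p = 1" by (auto simp: S_def)
      have p2: "p \<ge> 2" using F pF prime_ge_2_nat by blast
      have "q ^ b p < 2 * p ^ l p" using sum_power_lt[OF p2, of "l p"] sg[OF pF(1)] pF(2) by simp
      also have "\<dots> \<le> p ^ (l p + 1)" using p2 by simp
      \<comment> \<open>The cube originates here: \<open>l + 1\<close> is at most
        \<open>3 * (l - 1)\<close> precisely when \<open>l\<close> is at least 2.\<close>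
      also have "\<dots> \<le> p ^ ((l p - 1) * 3)" using p2 S(1)[OF p] by (intro power_increasing) auto
      finally show "q ^ b p \<le> (p ^ (l p - 1)) ^ 3" by (simp add: power_mult)
    qed
    also have "\<dots> = (\<Prod>p\<in>S. p ^ (l p - 1)) ^ 3" by (rule prod_power_distrib[symmetric])
    also have "\<dots> \<le> (k * Suc \<alpha>) ^ 3"
    proof (rule power_mono[OF dvd_imp_le])
      show "(\<Prod>p\<in>S. p ^ (l p - 1)) dvd k * Suc \<alpha>"
        using S F FSR by (intro prod_prime_powers_dvd) auto
    qed (use k0 in auto)
    also have "\<dots> \<le> (K * Suc \<alpha>) ^ 3" using kK by (intro power_mono mult_le_mono1) auto
    \<comment> \<open>The fourth power is to be compared with \<open>q ^ (2 * \<alpha>)\<close>: one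
      factor \<open>q ^ \<alpha>\<close> absorbs \<open>2 ^ \<alpha>\<close>, the other exceeds
      \<open>12 ^ 12 * K ^ 12\<close>. Hence \<open>S\<close> contributes less than half of
      \<open>\<alpha>\<close>.\<close>
    finally have "(q ^ (\<Sum>p\<in>S. b p)) ^ 4 \<le> ((K * Suc \<alpha>) ^ 3) ^ 4" by (rule power_mono) simp
    then have "q ^ ((\<Sum>p\<in>S. b p) * 4) \<le> K ^ 12 * (\<alpha> + 1) ^ 12"
      by (simp only: power_mult[symmetric] power_mult_distrib) simp
    also have "\<dots> \<le> K ^ 12 * (12 ^ 12 * 2 ^ \<alpha>)" by (intro mult_le_mono2 Suc_power_12_le)
    also have "\<dots> \<le> (12 ^ 12 * K ^ 12) * q ^ \<alpha>"
      using q2 power_mono[of 2 q \<alpha>] by simp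
    also have "\<dots> < q ^ \<alpha> * q ^ \<alpha>" using False q0 by simp
    also have "\<dots> = q ^ (2 * \<alpha>)" by (simp add: mult_2 power_add)
    finally have "(\<Sum>p\<in>S. b p) * 4 < 2 * \<alpha>" using q2 by (simp add: power_strict_increasing_iff)
    moreover have "\<alpha> = (\<Sum>p\<in>S. b p) + (\<Sum>p\<in>R. b p)"
      unfolding ab FSR(1) using FSR by (intro sum.union_disjoint) auto
    ultimately have bR: "\<alpha> < 2 * (\<Sum>p\<in>R. b p)" by simp
    have "(2::nat) ^ card R = (\<Prod>p\<in>R. 2)" by simp
    also have "\<dots> \<le> (\<Prod>p\<in>R. m p)" by (intro prod_mono) (auto simp: R_def)
    also have "\<dots> \<le> k"
    proof (rule dvd_imp_le)
      show "(\<Prod>p\<in>R. m p) dvd k" unfolding km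
        using finF by (rule prod_dvd_prod_subset) (auto simp: R_def)
    qed (use k0 in simp)
    finally have cR: "card R \<le> K" using less_exp[of "card R"] kK by linarith
    \<comment> \<open>Averaging: at most \<open>K\<close> components in \<open>R\<close> share more
      than half of \<open>\<alpha>\<close>.\<close>
    have "\<exists>p\<in>R. \<alpha> \<le> 2 * K * b p"
    proof (rule ccontr)
      assume "\<not> ?thesis"
      then have "2 * K * b p \<le> \<alpha>" if "p \<in> R" for p using that by force
      then have "(\<Sum>p\<in>R. 2 * K * b p) \<le> card R * \<alpha>"
        using sum_bounded_above[of R "\<lambda>p. 2 * K * b p" \<alpha>] by simp
      also have "\<dots> \<le> K * \<alpha>" using cR by simp
      also have "(\<Sum>p\<in>R. 2 * K * b p) = K * (2 * (\<Sum>p\<in>R. b p))"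
        unfolding sum_distrib_left by (simp add: mult_ac)
      finally have "K * (2 * (\<Sum>p\<in>R. b p)) \<le> K * \<alpha>" .
      then show False using bR k0 kK by simp
    qed
    then obtain p where p: "p \<in> R" "\<alpha> \<le> 2 * K * b p" by blast
    have pF: "p \<in> F" and m2: "2 \<le> m p" using p by (auto simp: R_def)
    have b1: "1 \<le> b p" using p al by (cases "b p") auto
    have "m p dvd k" unfolding km using finF pF by (rule dvd_prodI)
    then have mK: "m p \<le> K" using k0 kK by (meson dvd_imp_le le_trans less_le_trans zero_less_one)
    have "b p \<le> \<alpha>" unfolding ab using finF pF by (intro member_le_sum) auto
    \<comment> \<open>Multiplying by \<open>q - 1\<close> collapses the geometric sum
      \<open>G\<close> and gives the congruence required by \<open>component_bounded\<close> with
      exponent \<open>Suc \<alpha>\<close>.\<close>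
    have "int p ^ l p dvd (int q - 1) * (int k * int G)"
      using F(4)[OF pF] by (metis dvd_mult of_nat_dvd_iff of_nat_mult of_nat_power)
    also have "\<dots> = int k * ((int q - 1) * (\<Sum>i<Suc \<alpha>. int q ^ i))"
      by (simp add: G_def mult_ac)
    also have "\<dots> = int k * int q ^ Suc \<alpha> - int k"
      unfolding power_diff_1_eq[symmetric] by (simp add: right_diff_distrib)
    finally have "[int k * int q ^ Suc \<alpha> = int k] (mod int p ^ l p)"
      by (simp add: cong_iff_dvd_diff)
    \<comment> \<open>The factor doubles from \<open>2 * K\<close> to \<open>4 * K\<close> because
      \<open>\<alpha> + 1\<close> is at most \<open>2 * \<alpha>\<close>.\<close>
    moreover have "Suc \<alpha> \<le> 4 * K * b p" using p(2) b1 al by linarith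
    ultimately have comp: "p ^ l p \<le> component_bound K"
      using F[OF pF] sg[OF pF] q m2 mK k0 kK b1 \<open>b p \<le> \<alpha>\<close>
      by (intro component_bounded[of q p "l p" "m p" "b p" K k "Suc \<alpha>"]) auto
    have p2: "p \<ge> 2" using F pF prime_ge_2_nat by blast
    have "2 * q ^ b p \<le> m p * q ^ b p" using m2 by simp
    also have "\<dots> < 2 * p ^ l p" using sum_power_lt[OF p2, of "l p"] sg(4)[OF pF] by simp
    finally have qb: "q ^ b p \<le> component_bound K" using comp by simp
    have "q ^ \<alpha> \<le> q ^ (b p * (4 * K))" using p(2) q0 by (intro power_increasing) (auto simp: mult_ac)
    also have "\<dots> \<le> component_bound K ^ (4 * K)"
      unfolding power_mult using qb by (intro power_mono) auto
    finally show ?thesis by simp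
  qed simp
  then have sq: "q ^ \<alpha> * q ^ \<alpha> \<le> (12 ^ 12 * K ^ 12 + component_bound K ^ (4 * K)) ^ 2"
    unfolding power2_eq_square by (rule mult_le_mono) fact
  have "n \<le> sigma n" unfolding sigma_def using n0 by (intro member_le_sum) auto
  also have "\<dots> \<le> K * q ^ \<alpha>" using kK by (simp add: k)
  finally have "N \<le> K * (q ^ \<alpha> * q ^ \<alpha>)" by (simp add: Nn mult_ac)
  also have "\<dots> \<le> odd_perfect_bound K" unfolding odd_perfect_bound_def using sq by (rule mult_le_mono2)
  finally show ?thesis .
qed

lemma computable_odd_perfect_bound: "computable odd_perfect_bound"
proof -
  have eq: "odd_perfect_bound = (\<lambda>K. K * (12 ^ 12 * K ^ 12 +
      (8 * K ^ 2 * (K * (8 * K ^ 2) * (2 * K) ^ (4 * K + 1)) ^ (4 * K + 1)) ^ (4 * K)) ^ 2)"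
    by (rule ext) (simp only: odd_perfect_bound_def component_bound_def)
  show ?thesis unfolding eq
    by (intro computable_mult computable_add computable_power computable_const computable_id)
qed

theorem theorem1p2:
  shows "(\<forall>K::real. K > 5 \<longrightarrow> finite (odd_perfect_ratio_below K)) \<and>
    (\<exists>B::nat \<Rightarrow> nat. computable B \<and>
      (\<forall>K::real. K > 5 \<longrightarrow> (\<forall>N\<in>odd_perfect_ratio_below K. N \<le> B (nat \<lceil>K\<rceil>))))"
proof -
  \<comment> \<open>Rounding \<open>K\<close> up turns the strict real inequality into the
    natural-number hypothesis of \<open>odd_perfect_le\<close>; this one bound yields both
    finiteness and effectivity.\<close>
  have le: "N \<le> odd_perfect_bound (nat \<lceil>K\<rceil>)" if N: "N \<in> odd_perfect_ratio_below K" for K N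
  proof -
    obtain q \<alpha> where N: "odd N" "perfect N" and q: "prime q" "\<alpha> \<ge> 1" "exactly_divides q \<alpha> N"
      and lt: "real (sigma (N div q ^ \<alpha>)) / real (q ^ \<alpha>) < K"
      using N unfolding odd_perfect_ratio_below_def by blast
    have q0: "real (q ^ \<alpha>) > 0" using q by (simp add: prime_gt_0_nat)
    have "real (sigma (N div q ^ \<alpha>)) < K * real (q ^ \<alpha>)"
      using lt q0 by (simp add: pos_divide_less_eq)
    also have "\<dots> \<le> real (nat \<lceil>K\<rceil>) * real (q ^ \<alpha>)"
      using q0 by (intro mult_right_mono real_nat_ceiling_ge) auto
    finally have "sigma (N div q ^ \<alpha>) \<le> nat \<lceil>K\<rceil> * q ^ \<alpha>"
      by (simp only: of_nat_mult[symmetric] of_nat_less_iff)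
    then show ?thesis using N q by (intro odd_perfect_le)
  qed
  then have "odd_perfect_ratio_below K \<subseteq> {..odd_perfect_bound (nat \<lceil>K\<rceil>)}" for K
    unfolding subset_iff atMost_iff by blast
  then have "finite (odd_perfect_ratio_below K)" for K
    by (rule finite_subset) (rule finite_atMost)
  then show ?thesis
    by (intro conjI exI[of _ odd_perfect_bound] allI impI ballI computable_odd_perfect_bound le)
qed


end
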